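(* There exist a strictly stationary ergodic sequence $(X_i)_{i\geq 1}$ of real-valued random variables and a symmetric measurable function $h\colon\mathbb{R}^2\to\mathbb{R}$ such that for each $i<j$, $\mathbb{E}[|h(X_i,X_j)|]$ is finite, but the sequence $$\left(\binom{n}{2}^{-1}\sum_{1\leq i<j\leq n}\bigl(h(X_i,X_j)-\mathbb{E}[h(X_i,X_j)]\bigr)\right)_{n\geq 2}$$ does not converge in probability.
   Context: "Symmetric" means $h(x,y)=h(y,x)$ for all $x,y\in\mathbb{R}$. "Does not converge in probability" means that there is no random variable to which the sequence converges in probability. *)

theory Defs
  imports "HOL-Probability.Probability"
begin

text \<open>Sequences of random variables are indexed by the positive integers; the value of
  \<open>X\<close> at index 0 is irrelevant throughout.\<close>

abbreviation path_space :: "(nat \<Rightarrow> real) measure" where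
  "path_space \<equiv> \<Pi>\<^sub>M i\<in>{1..}. (borel :: real measure)"

definition process_law :: "'a measure \<Rightarrow> (nat \<Rightarrow> 'a \<Rightarrow> real) \<Rightarrow> (nat \<Rightarrow> real) measure" where
  "process_law M X = distr M path_space (\<lambda>\<omega>. \<lambda>i\<in>{1..}. X i \<omega>)"

definition strictly_stationary :: "'a measure \<Rightarrow> (nat \<Rightarrow> 'a \<Rightarrow> real) \<Rightarrow> bool" where
  "strictly_stationary M X \<longleftrightarrow> (\<forall>k. process_law M (\<lambda>i. X (i + k)) = process_law M X)"

text \<open>Elements of \<open>path_space\<close> are \<open>undefined\<close> at index 0, so the shift has to be restricted
  to \<open>{1..}\<close> in order to map the space into itself.\<close>

definition path_shift :: "(nat \<Rightarrow> real) \<Rightarrow> nat \<Rightarrow> real" where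
  "path_shift x = (\<lambda>i\<in>{1..}. x (i + 1))"

text \<open>For a strictly stationary process, this is ergodicity of the shift under the law of the
  process.\<close>

definition ergodic_process :: "'a measure \<Rightarrow> (nat \<Rightarrow> 'a \<Rightarrow> real) \<Rightarrow> bool" where
  "ergodic_process M X \<longleftrightarrow>
     (\<forall>A\<in>sets path_space. path_shift -` A \<inter> space path_space = A \<longrightarrow>
        measure (process_law M X) A = 0 \<or> measure (process_law M X) A = 1)"

definition converges_in_probability ::
    "'a measure \<Rightarrow> (nat \<Rightarrow> 'a \<Rightarrow> real) \<Rightarrow> ('a \<Rightarrow> real) \<Rightarrow> bool" where
  "converges_in_probability M Y Z \<longleftrightarrow>
     (\<forall>\<epsilon>>0. (\<lambda>n. measure M {\<omega> \<in> space M. \<bar>Y n \<omega> - Z \<omega>\<bar> > \<epsilon>}) \<longlonglongrightarrow> 0)"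

end

theory Submission
  imports Defs
begin

text \<open>Let \<open>X i\<close> be a real number coding the whole future, from time \<open>i\<close> on, of a sequence of fair
  independent signs \<open>s\<close>. This is a factor of a Bernoulli shift, hence stationary and ergodic. For
  \<open>i < j\<close>, the value \<open>X j\<close> arises from \<open>X i\<close> by applying \<open>j - i\<close> times a fixed decoding map, and
  almost surely the lag \<open>j - i\<close> can be read off the unordered pair of values. So a kernel can weight
  \<open>s i * s j\<close>, whose mean is zero, by any function of the lag. If the weight grows fast enough,
  the single term with \<open>i = 1\<close>, \<open>j = n\<close> dominates the sum, and the absolute value of the average
  tends to infinity almost surely.\<close>

section \<open>Bernoulli shifts\<close>

definition left_shift :: "nat \<Rightarrow> (nat \<Rightarrow> 'a) \<Rightarrow> nat \<Rightarrow> 'a" where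
  "left_shift k \<omega> = (\<lambda>n. \<omega> (n + k))"

lemma measurable_left_shift [measurable]:
  "left_shift k \<in> PiM UNIV (\<lambda>_. D) \<rightarrow>\<^sub>M PiM UNIV (\<lambda>_. D)"
  unfolding left_shift_def
  by (rule measurable_PiM_single') (auto simp: space_PiM)

lemma distr_left_shift:
  assumes "prob_space D"
  shows "distr (PiM UNIV (\<lambda>_. D)) (PiM UNIV (\<lambda>_. D)) (left_shift k) = PiM UNIV (\<lambda>_::nat. D)"
  using distr_PiM_reindex[of UNIV "\<lambda>_. D" "\<lambda>n::nat. n + k" UNIV] assms
  by (simp add: left_shift_def[abs_def] restrict_UNIV)

text \<open>Independence amounts to the joint law being the product of the marginals; here the joint
  law of all coordinates is the product measure itself.\<close>

lemma indep_vars_PiM_coordinates: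
  assumes "prob_space D"
  shows "prob_space.indep_vars (PiM UNIV (\<lambda>_. D)) (\<lambda>_. D) (\<lambda>i \<omega>. \<omega> i) (UNIV :: nat set)"
proof -
  interpret P: prob_space "PiM UNIV (\<lambda>_::nat. D)"
    using assms by (rule prob_space_PiM)
  have "distr (PiM UNIV (\<lambda>_. D)) (PiM UNIV (\<lambda>_. D)) (\<lambda>\<omega>. \<omega>) = PiM UNIV (\<lambda>_::nat. D)"
    by (rule distr_id)
  moreover have "distr (PiM UNIV (\<lambda>_. D)) D (\<lambda>\<omega>. \<omega> i) = D" for i :: nat
    using assms by (intro distr_PiM_component) auto
  ultimately show ?thesis
    by (subst P.indep_vars_iff_distr_eq_PiM) (auto simp: restrict_UNIV)
qed

text \<open>An invariant event equals its preimage under every \<open>left_shift n\<close>, so it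
  depends only on the coordinates from \<open>n\<close> on, for every \<open>n\<close>. It is thus a
  tail event of independent coordinates, and Kolmogorov's 0-1 law applies.\<close>

lemma left_shift_invariant_0_1:
  fixes D :: "'a measure"
  defines "P \<equiv> PiM UNIV (\<lambda>_::nat. D)"
  assumes D: "prob_space D"
    and B: "B \<in> sets P"
    and inv: "left_shift 1 -` B \<inter> space P = B"
  shows "measure P B = 0 \<or> measure P B = 1"
proof -
  interpret P: prob_space P
    unfolding P_def using D by (rule prob_space_PiM)
  define A where "A i = sigma_sets (space P) {(\<lambda>\<omega>. \<omega> i) -` C \<inter> space P | C. C \<in> sets D}" for i
  have indep: "P.indep_sets A UNIV"
    using indep_vars_PiM_coordinates[OF D] unfolding P_def[symmetric] P.indep_vars_def A_def by simp
  have B_eq: "B = left_shift n -` B \<inter> space P" for n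
  proof (induction n)
    case 0
    then show ?case using sets.sets_into_space[OF B] by (auto simp: left_shift_def)
  next
    case (Suc n)
    have "left_shift (Suc n) -` B \<inter> space P = left_shift n -` (left_shift 1 -` B \<inter> space P) \<inter> space P"
      using measurable_space[OF measurable_left_shift[of n D]]
      by (auto simp: left_shift_def P_def add.commute)
    with Suc inv show ?case by simp
  qed
  have "B \<in> sigma_sets (space P) (\<Union> (A ` {n..}))" for n
  proof -
    let ?S = "sigma (space P) (\<Union> (A ` {n..}))"
    have sub: "\<Union> (A ` {n..}) \<subseteq> Pow (space P)"
      unfolding A_def using sigma_sets_into_sp[of "{_ -` C \<inter> space P | C. C \<in> sets D}" "space P"]
      by blast
    \<comment> \<open>Coordinate \<open>i\<close> of the shifted sequence is coordinate
      \<open>i + n\<close> of the original, so it is measurable for the sigma-algebra generated by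
      the coordinates from \<open>n\<close> on.\<close>
    have "left_shift n \<in> ?S \<rightarrow>\<^sub>M P"
      unfolding P_def left_shift_def
    proof (rule measurable_PiM_single')
      fix i :: nat
      show "(\<lambda>\<omega>. \<omega> (i + n)) \<in> sigma (space (Pi\<^sub>M UNIV (\<lambda>_. D))) (\<Union> (A ` {n..})) \<rightarrow>\<^sub>M D"
      proof (rule measurableI)
        fix C assume "C \<in> sets D"
        then have "(\<lambda>\<omega>. \<omega> (i + n)) -` C \<inter> space P \<in> A (i + n)"
          unfolding A_def by (intro sigma_sets.Basic) auto
        then show "(\<lambda>\<omega>. \<omega> (i + n)) -` C \<inter> space (sigma (space (Pi\<^sub>M UNIV (\<lambda>_. D))) (\<Union> (A ` {n..})))
            \<in> sets (sigma (space (Pi\<^sub>M UNIV (\<lambda>_. D))) (\<Union> (A ` {n..})))"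
          using sub unfolding P_def[symmetric] by (auto intro!: sigma_sets.Basic bexI[of _ "i + n"])
      qed (use sub in \<open>auto simp: space_PiM P_def\<close>)
    qed (use sub in \<open>auto simp: space_PiM P_def\<close>)
    then have "left_shift n -` B \<inter> space ?S \<in> sets ?S"
      using B by (rule measurable_sets)
    with sub show ?thesis
      by (simp add: B_eq[of n, symmetric])
  qed
  then have "B \<in> P.tail_events A"
    by (simp add: P.tail_events_def)
  moreover have "sigma_algebra (space P) (A i)" for i
    unfolding A_def by (rule sigma_algebra_sigma_sets) auto
  ultimately show ?thesis
    using P.kolmogorov_0_1_law indep by blast
qed

section \<open>Shift processes\<close>

lemma measurable_shift_process:
  assumes "g \<in> borel_measurable (PiM UNIV (\<lambda>_::nat. D))"
  shows "(\<lambda>\<omega>. \<lambda>i\<in>{1..}. g (left_shift i \<omega>)) \<in> PiM UNIV (\<lambda>_. D) \<rightarrow>\<^sub>M path_space"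
  by (intro measurable_restrict measurable_compose[OF measurable_left_shift assms])

text \<open>Delaying the process by \<open>k\<close> is precomposition with
  \<open>left_shift k\<close>, which preserves the product measure.\<close>

lemma strictly_stationary_shift_process:
  fixes D :: "real measure"
  assumes D: "prob_space D" and g: "g \<in> borel_measurable (PiM UNIV (\<lambda>_::nat. D))"
  shows "strictly_stationary (PiM UNIV (\<lambda>_. D)) (\<lambda>i \<omega>. g (left_shift i \<omega>))"
  unfolding strictly_stationary_def
proof
  fix k
  let ?P = "PiM UNIV (\<lambda>_::nat. D)"
  let ?F = "\<lambda>\<omega>. \<lambda>i\<in>{1::nat..}. g (left_shift i \<omega>)"
  have "(\<lambda>\<omega>. \<lambda>i\<in>{1..}. g (left_shift (i + k) \<omega>)) = ?F \<circ> left_shift k"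
    by (auto simp: fun_eq_iff left_shift_def add.assoc)
  then have "process_law ?P (\<lambda>i \<omega>. g (left_shift (i + k) \<omega>)) = distr (distr ?P ?P (left_shift k)) path_space ?F"
    unfolding process_law_def
    using measurable_shift_process[OF g] by (simp add: distr_distr)
  then show "process_law ?P (\<lambda>i \<omega>. g (left_shift (i + k) \<omega>)) = process_law ?P (\<lambda>i \<omega>. g (left_shift i \<omega>))"
    by (simp add: distr_left_shift[OF D] process_law_def)
qed

text \<open>The path map intertwines the two shifts, so it pulls an invariant set of paths back to
  an invariant event, to which the 0-1 law applies.\<close>

lemma ergodic_shift_process:
  fixes D :: "real measure"
  assumes D: "prob_space D" and g: "g \<in> borel_measurable (PiM UNIV (\<lambda>_::nat. D))"
  shows "ergodic_process (PiM UNIV (\<lambda>_. D)) (\<lambda>i \<omega>. g (left_shift i \<omega>))"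
  unfolding ergodic_process_def
proof (intro ballI impI)
  let ?P = "PiM UNIV (\<lambda>_::nat. D)"
  let ?F = "\<lambda>\<omega>. \<lambda>i\<in>{1::nat..}. g (left_shift i \<omega>)"
  fix A assume A: "A \<in> sets path_space" and inv: "path_shift -` A \<inter> space path_space = A"
  have F: "?F \<in> ?P \<rightarrow>\<^sub>M path_space"
    by (rule measurable_shift_process[OF g])
  \<comment> \<open>At index 0 both sides are \<open>undefined\<close>, so this is an equality of
    whole functions.\<close>
  have shift: "?F (left_shift 1 \<omega>) = path_shift (?F \<omega>)" for \<omega>
    by (auto simp: path_shift_def left_shift_def fun_eq_iff)
  have space: "?F \<omega> \<in> space path_space" for \<omega>
    by (simp add: space_PiM)
  have "?F (left_shift 1 \<omega>) \<in> A \<longleftrightarrow> ?F \<omega> \<in> A" for \<omega>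
    unfolding shift using inv space[of \<omega>] by blast
  then have "left_shift 1 -` (?F -` A \<inter> space ?P) \<inter> space ?P = ?F -` A \<inter> space ?P"
    using measurable_space[OF measurable_left_shift[of 1 D]] by auto
  then have "measure ?P (?F -` A \<inter> space ?P) = 0 \<or> measure ?P (?F -` A \<inter> space ?P) = 1"
    using left_shift_invariant_0_1[OF D measurable_sets[OF F A]] by blast
  then show "measure (process_law ?P (\<lambda>i \<omega>. g (left_shift i \<omega>))) A = 0 \<or>
      measure (process_law ?P (\<lambda>i \<omega>. g (left_shift i \<omega>))) A = 1"
    unfolding process_law_def measure_distr[OF F A] .
qed

section \<open>Coding a sign sequence by a real number\<close>

text \<open>Unlike \<open>sgn\<close>, this is -1 at 0, so its absolute value is 1 everywhere and
  not only almost everywhere.\<close>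

definition sign_bit :: "real \<Rightarrow> real" where
  "sign_bit x = (if x > 0 then 1 else - 1)"

text \<open>The base is 3 because the terms after the first then add up to at most 1/2 in absolute
  value, so the leading sign can always be recovered. In base 2 they could cancel it.\<close>

definition sign_code :: "(nat \<Rightarrow> real) \<Rightarrow> real" where
  "sign_code \<omega> = (\<Sum>k. sign_bit (\<omega> k) / 3 ^ k)"

text \<open>On codes this deletes the leading digit, which is the sign of the number, and rescales
  the remainder.\<close>

definition code_step :: "real \<Rightarrow> real" where
  "code_step x = 3 * (x - sgn x)"

lemma abs_sign_bit [simp]: "\<bar>sign_bit x\<bar> = 1"
  by (simp add: sign_bit_def)

lemma measurable_sign_bit [measurable]: "sign_bit \<in> borel_measurable borel"
  unfolding sign_bit_def by measurable

lemma measurable_code_step [measurable]: "code_step \<in> borel_measurable borel"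
  unfolding code_step_def[abs_def] by measurable

lemma summable_sign_code: "summable (\<lambda>k. sign_bit (\<omega> k) / 3 ^ k)"
  by (rule summable_comparison_test'[of "\<lambda>k. (1 / 3) ^ k" 0])
     (auto simp: abs_divide simp flip: power_one_over intro: summable_geometric)

lemma sign_code_rec: "sign_code \<omega> = sign_bit (\<omega> 0) + sign_code (left_shift 1 \<omega>) / 3"
proof -
  have "sign_code \<omega> = sign_bit (\<omega> 0) + (\<Sum>k. sign_bit (\<omega> (Suc k)) / 3 ^ Suc k)"
    unfolding sign_code_def using suminf_split_head[OF summable_sign_code[of \<omega>]] by simp
  also have "(\<Sum>k. sign_bit (\<omega> (Suc k)) / 3 ^ Suc k) = sign_code (left_shift 1 \<omega>) / 3"
    unfolding sign_code_def using suminf_divide[OF summable_sign_code[of "left_shift 1 \<omega>"], of 3]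
    by (simp add: left_shift_def mult.commute)
  finally show ?thesis .
qed

lemma abs_sign_code_le: "\<bar>sign_code \<omega>\<bar> \<le> 3 / 2"
proof -
  have "\<bar>sign_code \<omega>\<bar> \<le> (\<Sum>k. (1 / 3) ^ k)"
    unfolding sign_code_def real_norm_def[symmetric]
    by (rule norm_suminf_le) (auto simp: abs_divide simp flip: power_one_over intro: summable_geometric)
  then show ?thesis by (simp add: suminf_geometric)
qed

lemma sgn_sign_code: "sgn (sign_code \<omega>) = sign_bit (\<omega> 0)"
proof (cases "\<omega> 0 > 0")
  case True
  with sign_code_rec[of \<omega>] abs_sign_code_le[of "left_shift 1 \<omega>"] have "sign_code \<omega> > 0"
    unfolding sign_bit_def abs_le_iff by simp
  with True show ?thesis by (simp add: sign_bit_def)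
next
  case False
  with sign_code_rec[of \<omega>] abs_sign_code_le[of "left_shift 1 \<omega>"] have "sign_code \<omega> < 0"
    unfolding sign_bit_def abs_le_iff by simp
  with False show ?thesis by (simp add: sign_bit_def)
qed

lemma code_step_sign_code: "code_step (sign_code \<omega>) = sign_code (left_shift 1 \<omega>)"
  unfolding code_step_def sgn_sign_code by (subst sign_code_rec[of \<omega>]) simp

lemma code_step_funpow_sign_code: "(code_step ^^ k) (sign_code \<omega>) = sign_code (left_shift k \<omega>)"
  by (induction k) (auto simp: code_step_sign_code left_shift_def)

lemma measurable_sign_code:
  assumes "sets D = sets borel"
  shows "sign_code \<in> borel_measurable (PiM UNIV (\<lambda>_::nat. D))"
proof -
  have [measurable]: "(\<lambda>\<omega>. \<omega> k) \<in> borel_measurable (PiM UNIV (\<lambda>_::nat. D))" for k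
    using measurable_component_singleton[of k UNIV "\<lambda>_::nat. D"]
    by (simp add: measurable_cong_sets[OF refl assms])
  show ?thesis unfolding sign_code_def[abs_def] by measurable
qed

section \<open>Independent fair signs and the absence of code collisions\<close>

definition fair_law :: "real measure" where
  "fair_law = uniform_measure lborel {- 1..1}"

abbreviation fair_space :: "(nat \<Rightarrow> real) measure" where
  "fair_space \<equiv> PiM UNIV (\<lambda>_. fair_law)"

lemma sets_fair_law [simp, measurable_cong]: "sets fair_law = sets borel"
  by (simp add: fair_law_def)

lemma space_fair_law [simp]: "space fair_law = UNIV"
  by (simp add: fair_law_def)

lemma prob_space_fair_law: "prob_space fair_law"
  unfolding fair_law_def by (rule prob_space_uniform_measure) auto

interpretation fair: product_prob_space "\<lambda>_::nat. fair_law" UNIV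
  using prob_space_fair_law
  by (simp add: product_prob_space_def product_prob_space_axioms_def product_sigma_finite_def
      prob_space_imp_sigma_finite)

lemma measure_fair_law_sign_bit:
  assumes "\<bar>s\<bar> = 1"
  shows "measure fair_law {x. sign_bit x = s} = 1 / 2"
proof -
  \<comment> \<open>The point 0 belongs to the negative half; each half has length 1 out of
    2.\<close>
  have "{-1..1} \<inter> {x. sign_bit x = s} = (if s = 1 then {0<..1} else {-1..0::real})"
    using assms by (auto simp: sign_bit_def)
  then show ?thesis unfolding fair_law_def
    by (subst measure_uniform_measure) auto
qed

lemma expectation_sign_bit: "(\<integral>x. sign_bit x \<partial>fair_law) = 0"
proof -
  let ?A = "\<lambda>s. {x. sign_bit x = s}"
  have int: "integrable fair_law (indicator (?A s) :: real \<Rightarrow> real)" for s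
    by (intro integrable_real_indicator) (auto simp: fair.M.emeasure_eq_measure)
  have "(\<integral>x. sign_bit x \<partial>fair_law) = (\<integral>x. indicator (?A 1) x - indicator (?A (- 1)) x \<partial>fair_law)"
    by (intro Bochner_Integration.integral_cong) (auto simp: sign_bit_def)
  also have "\<dots> = measure fair_law (?A 1) - measure fair_law (?A (- 1))"
    by (subst Bochner_Integration.integral_diff[OF int int]) simp
  finally show ?thesis by (simp add: measure_fair_law_sign_bit)
qed

text \<open>By independence the expectation factorizes, and each factor has mean zero.\<close>

lemma expectation_sign_bit_mult:
  assumes "i \<noteq> j"
  shows "(\<integral>\<omega>. sign_bit (\<omega> i) * sign_bit (\<omega> j) \<partial>fair_space) = 0"
proof -
  have indep: "fair.P.indep_vars (\<lambda>_. borel) (\<lambda>i \<omega>. sign_bit (\<omega> i)) {i, j}"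
    using fair.P.indep_vars_compose2[OF indep_vars_PiM_coordinates[OF prob_space_fair_law]]
    by (rule fair.P.indep_vars_subset) measurable
  have E: "(\<integral>\<omega>. sign_bit (\<omega> k) \<partial>fair_space) = 0" for k
    using integral_distr[of "\<lambda>\<omega>. \<omega> k" fair_space fair_law sign_bit] expectation_sign_bit
    by (simp add: fair.PiM_component)
  have "integrable fair_space (\<lambda>\<omega>. sign_bit (\<omega> k))" for k
    by (rule fair.P.integrable_const_bound[of _ 1]) auto
  then show ?thesis
    using fair.P.indep_vars_lebesgue_integral[OF _ indep] assms E by simp
qed

text \<open>A collision of the codes at times \<open>i < j\<close> forces the signs to be periodic with period
  \<open>j - i\<close> from time \<open>i\<close> on.\<close>

lemma AE_sign_code_left_shift_neq:
  assumes "i \<noteq> j"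
  shows "AE \<omega> in fair_space. sign_code (left_shift i \<omega>) \<noteq> sign_code (left_shift j \<omega>)"
proof -
  have *: "AE \<omega> in fair_space. sign_code (left_shift i \<omega>) \<noteq> sign_code (left_shift (i + d) \<omega>)"
    if "d > 0" for i d
  proof -
    \<comment> \<open>The signs are constantly \<open>s\<close> along the progression
      \<open>i\<close>, \<open>i + d\<close>, \<open>i + 2 * d\<close>, and so on.\<close>
    let ?C = "\<lambda>s. {\<omega>\<in>space fair_space. \<forall>m. sign_bit (\<omega> (i + m * d)) = s}"
    have C: "?C s \<in> null_sets fair_space" if "\<bar>s\<bar> = 1" for s
    proof -
      have le: "measure fair_space (?C s) \<le> (1 / 2) ^ N" for N
      proof -
        \<comment> \<open>The first \<open>N\<close> terms of the progression are distinct since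
          \<open>d > 0\<close>; by independence their signs all equal \<open>s\<close> with
          probability \<open>(1 / 2) ^ N\<close>.\<close>
        let ?J = "(\<lambda>m. i + m * d) ` {..<N}"
        have "measure fair_space (?C s) \<le>
            measure fair_space {\<omega>\<in>space fair_space. \<forall>n\<in>?J. \<omega> n \<in> {x. sign_bit x = s}}"
          by (intro fair.P.finite_measure_mono) auto
        also have "\<dots> = (\<Prod>n\<in>?J. measure fair_law {x. sign_bit x = s})"
          unfolding measure_def using fair.emeasure_PiM_Collect[of ?J "\<lambda>_. {x. sign_bit x = s}"]
          by (simp add: fair.M.emeasure_eq_measure prod_ennreal prod_nonneg del: prod_constant)
        also have "\<dots> = (1 / 2) ^ card ?J"
          using that by (simp add: measure_fair_law_sign_bit)
        also have "card ?J = N"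
          using \<open>d > 0\<close> by (subst card_image) (auto simp: inj_on_def)
        finally show ?thesis .
      qed
      have "(\<lambda>N. (1 / 2 :: real) ^ N) \<longlonglongrightarrow> 0"
        by (rule LIMSEQ_power_zero) simp
      then have "measure fair_space (?C s) \<le> 0"
        by (rule LIMSEQ_le_const) (use le in auto)
      then have "measure fair_space (?C s) = 0"
        by (simp add: measure_le_0_iff)
      then show ?thesis
        by (simp add: null_sets_def fair.P.emeasure_eq_measure)
    qed
    have "?C 1 \<union> ?C (- 1) \<in> null_sets fair_space"
      using C by (intro null_sets.Un) auto
    then show ?thesis
    proof (rule AE_I')
      show "{\<omega> \<in> space fair_space. \<not> sign_code (left_shift i \<omega>) \<noteq> sign_code (left_shift (i + d) \<omega>)}
        \<subseteq> ?C 1 \<union> ?C (- 1)"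
      proof
        fix \<omega>
        assume "\<omega> \<in> {\<omega> \<in> space fair_space. \<not> sign_code (left_shift i \<omega>) \<noteq> sign_code (left_shift (i + d) \<omega>)}"
        then have space: "\<omega> \<in> space fair_space"
          and eq: "sign_code (left_shift i \<omega>) = sign_code (left_shift (i + d) \<omega>)"
          by auto
        \<comment> \<open>Decoding \<open>k\<close> times and taking \<open>sgn\<close> reads off
          the \<open>k\<close>-th sign of each of the two equal codes.\<close>
        have per: "sign_bit (\<omega> (i + k)) = sign_bit (\<omega> (i + d + k))" for k
          using arg_cong[OF eq, of "\<lambda>x. sgn ((code_step ^^ k) x)"]
          by (simp add: code_step_funpow_sign_code sgn_sign_code) (simp add: left_shift_def ac_simps)
        have const: "sign_bit (\<omega> (i + m * d)) = sign_bit (\<omega> i)" for m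
        proof (induction m)
          case (Suc m)
          with per[of "m * d"] show ?case by (simp add: ac_simps)
        qed simp
        show "\<omega> \<in> ?C 1 \<union> ?C (- 1)"
          using space unfolding Un_iff mem_Collect_eq const by (auto simp: sign_bit_def)
      qed
    qed
  qed
  show ?thesis
  proof (cases "i < j")
    case True
    then show ?thesis using *[of "j - i" i] by simp
  next
    case False
    then have "AE \<omega> in fair_space. sign_code (left_shift j \<omega>) \<noteq> sign_code (left_shift i \<omega>)"
      using *[of "i - j" j] assms by simp
    then show ?thesis by eventually_elim auto
  qed
qed

section \<open>The kernel\<close>

text \<open>The disjunction makes the lag independent of the order of the arguments, hence the
  kernel symmetric. If neither point reaches the other, the value is an unspecified but fixed
  number.\<close>

definition code_lag :: "real \<Rightarrow> real \<Rightarrow> nat" where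
  "code_lag x y = (LEAST k. 1 \<le> k \<and> ((code_step ^^ k) x = y \<or> (code_step ^^ k) y = x))"

text \<open>The choice gives \<open>lag_weight (n - 1) = n ^ 3 * lag_weight (n - 2)\<close> for
  \<open>n \<ge> 2\<close>; the factor \<open>n ^ 3\<close> has to beat both the number of pairs, of
  order \<open>n ^ 2\<close>, and the normalization of the average.\<close>

definition lag_weight :: "nat \<Rightarrow> real" where
  "lag_weight k = fact (Suc k) ^ 3"

definition lag_kernel :: "real \<Rightarrow> real \<Rightarrow> real" where
  "lag_kernel x y = sgn x * sgn y * lag_weight (code_lag x y)"

lemma code_lag_commute: "code_lag x y = code_lag y x"
  unfolding code_lag_def by (rule arg_cong[where f = Least]) auto

lemma lag_kernel_commute: "lag_kernel x y = lag_kernel y x"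
  by (simp add: lag_kernel_def code_lag_commute[of x y])

lemma measurable_lag_kernel:
  "(\<lambda>(x, y). lag_kernel x y) \<in> borel_measurable (borel \<Otimes>\<^sub>M borel)"
proof -
  have [measurable]: "code_step ^^ k \<in> borel_measurable borel" for k
    by (rule measurable_compose_n) measurable
  have "(\<lambda>z. code_lag (fst z) (snd z)) \<in> borel \<Otimes>\<^sub>M borel \<rightarrow>\<^sub>M count_space UNIV"
    unfolding code_lag_def by measurable
  then have [measurable]: "(\<lambda>z. lag_weight (code_lag (fst z) (snd z))) \<in> borel_measurable (borel \<Otimes>\<^sub>M borel)"
    by (rule measurable_compose) simp
  show ?thesis
    unfolding lag_kernel_def case_prod_beta by measurable
qed

abbreviation code_process :: "nat \<Rightarrow> (nat \<Rightarrow> real) \<Rightarrow> real" where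
  "code_process i \<omega> \<equiv> sign_code (left_shift i \<omega>)"

text \<open>With pairwise distinct codes, \<open>k\<close> decoding steps lead from time
  \<open>i\<close> to time \<open>j\<close> only if \<open>i + k = j\<close>; the reverse
  alternative \<open>j + k = i\<close> is excluded by \<open>i < j\<close>.\<close>

lemma code_lag_eq:
  assumes "i < j" and neq: "\<And>k l. k \<noteq> l \<Longrightarrow> code_process k \<omega> \<noteq> code_process l \<omega>"
  shows "code_lag (code_process i \<omega>) (code_process j \<omega>) = j - i"
proof -
  have shift: "left_shift k (left_shift l \<omega>) = left_shift (l + k) \<omega>" for k l
    by (simp add: left_shift_def ac_simps)
  have *: "code_process k \<omega> = code_process l \<omega> \<longleftrightarrow> k = l" for k l
    using neq by blast
  show ?thesis
    unfolding code_lag_def code_step_funpow_sign_code shift *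
    by (rule Least_equality) (use assms in auto)
qed

text \<open>There are only countably many pairs of times, so one null set contains all
  collisions.\<close>

lemma AE_lag_kernel:
  "AE \<omega> in fair_space. \<forall>i j. i < j \<longrightarrow>
     lag_kernel (code_process i \<omega>) (code_process j \<omega>) = sign_bit (\<omega> i) * sign_bit (\<omega> j) * lag_weight (j - i)"
proof -
  have "AE \<omega> in fair_space. \<forall>i j. i \<noteq> j \<longrightarrow> code_process i \<omega> \<noteq> code_process j \<omega>"
    unfolding AE_all_countable using AE_sign_code_left_shift_neq by auto
  then show ?thesis
    by eventually_elim (simp add: lag_kernel_def code_lag_eq sgn_sign_code, simp add: left_shift_def)
qed

text \<open>For fixed \<open>i < j\<close> the kernel agrees almost surely with a product of two
  distinct signs times a constant, which is bounded and has mean zero.\<close>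

lemma
  assumes "i < j"
  shows integrable_lag_kernel:
      "integrable fair_space (\<lambda>\<omega>. lag_kernel (code_process i \<omega>) (code_process j \<omega>))"
    and expectation_lag_kernel:
      "(\<integral>\<omega>. lag_kernel (code_process i \<omega>) (code_process j \<omega>) \<partial>fair_space) = 0"
proof -
  let ?f = "\<lambda>\<omega>. lag_kernel (code_process i \<omega>) (code_process j \<omega>)"
  let ?g = "\<lambda>\<omega>. sign_bit (\<omega> i) * sign_bit (\<omega> j) * lag_weight (j - i)"
  have [measurable]: "sign_code \<in> borel_measurable fair_space"
    by (rule measurable_sign_code) simp
  have "(\<lambda>\<omega>. (code_process i \<omega>, code_process j \<omega>)) \<in> fair_space \<rightarrow>\<^sub>M borel \<Otimes>\<^sub>M borel"
    by measurable
  from measurable_compose[OF this measurable_lag_kernel]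
  have f: "?f \<in> borel_measurable fair_space"
    by simp
  have g: "?g \<in> borel_measurable fair_space"
    by measurable
  have ae: "AE \<omega> in fair_space. ?f \<omega> = ?g \<omega>"
    using AE_lag_kernel by eventually_elim (use assms in simp)
  have int: "integrable fair_space ?g"
    using g by (rule fair.P.integrable_const_bound[rotated, of _ "lag_weight (j - i)"])
      (auto simp: abs_mult lag_weight_def)
  show "integrable fair_space ?f"
    using int integrable_cong_AE[OF f g ae] by simp
  have "(\<integral>\<omega>. ?f \<omega> \<partial>fair_space) = (\<integral>\<omega>. ?g \<omega> \<partial>fair_space)"
    by (rule integral_cong_AE[OF f g ae])
  then show "(\<integral>\<omega>. ?f \<omega> \<partial>fair_space) = 0"
    using expectation_sign_bit_mult[of i j] assms by simp
qed

section \<open>Counting the pairs and dominance of the extreme pair\<close>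

lemma card_ordered_pairs: "card {(i, j). 1 \<le> i \<and> i < j \<and> j \<le> n} = n choose 2"
proof (induction n)
  case 0
  have no_pairs: "{(i, j). 1 \<le> i \<and> i < j \<and> j \<le> (0::nat)} = {}" by auto
  show ?case unfolding no_pairs by simp
next
  case (Suc n)
  have fin: "finite {(i, j). 1 \<le> i \<and> i < j \<and> j \<le> n}"
    by (rule finite_subset[of _ "{..n} \<times> {..n}"]) auto
  have "{(i, j). 1 \<le> i \<and> i < j \<and> j \<le> Suc n} =
      {(i, j). 1 \<le> i \<and> i < j \<and> j \<le> n} \<union> (\<lambda>i. (i, Suc n)) ` {1..n}"
    by (auto simp: le_Suc_eq)
  moreover have "card ((\<lambda>i. (i, Suc n)) ` {1..n}) = n"
    by (subst card_image) (auto simp: inj_on_def)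
  ultimately have "card {(i, j). 1 \<le> i \<and> i < j \<and> j \<le> Suc n} =
      card {(i, j). 1 \<le> i \<and> i < j \<and> j \<le> n} + n"
    using fin by (simp add: card_Un_disjoint disjoint_iff image_iff)
  with Suc show ?case by (simp add: numeral_2_eq_2)
qed

text \<open>The pair \<open>(1, n)\<close> is the only one with lag \<open>n - 1\<close>, and its weight exceeds the total
  weight of all other pairs.\<close>

lemma weighted_sign_sum_ge:
  assumes "n \<ge> 2" and s: "\<And>i. \<bar>s i\<bar> = 1"
  shows "\<bar>\<Sum>(i, j)\<in>{(i, j). 1 \<le> i \<and> i < j \<and> j \<le> n}. s i * s j * lag_weight (j - i)\<bar>
    \<ge> real (n choose 2) * real n"
proof -
  let ?I = "{(i, j). 1 \<le> i \<and> i < j \<and> j \<le> n}"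
  let ?f = "\<lambda>(i, j). s i * s j * lag_weight (j - i)"
  let ?w = "lag_weight (n - 2)"
  obtain m where n: "n = Suc (Suc m)"
    using \<open>n \<ge> 2\<close> by (metis add_2_eq_Suc le_Suc_ex)
  have fin: "finite ?I"
    by (rule finite_subset[of _ "{..n} \<times> {..n}"]) auto
  have mem: "(1, n) \<in> ?I" using \<open>n \<ge> 2\<close> by auto
  \<comment> \<open>Here \<open>lag_weight (n - 1)\<close> is \<open>fact n ^ 3\<close>, and
    \<open>fact n = n * fact (n - 1)\<close> splits off \<open>n ^ 3\<close>.\<close>
  have top: "\<bar>?f (1, n)\<bar> = real n ^ 3 * ?w"
    using s by (simp add: abs_mult lag_weight_def n power_mult_distrib del: of_nat_Suc)
  have w: "?w \<ge> 1"
    unfolding lag_weight_def by (intro one_le_power fact_ge_1)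
  have "\<bar>sum ?f (?I - {(1, n)})\<bar> \<le> (\<Sum>z\<in>?I - {(1, n)}. \<bar>?f z\<bar>)"
    by (rule sum_abs)
  also have "\<dots> \<le> (\<Sum>z\<in>?I - {(1, n)}. ?w)"
  proof (rule sum_mono)
    \<comment> \<open>Every pair other than \<open>(1, n)\<close> has lag at most
      \<open>n - 2\<close>, and the weight is monotone.\<close>
    fix z assume "z \<in> ?I - {(1, n)}"
    then obtain i j where "z = (i, j)" "j - i \<le> n - 2"
      by (cases z) auto
    then show "\<bar>?f z\<bar> \<le> ?w"
      using s by (auto simp: abs_mult lag_weight_def simp del: fact_Suc intro!: power_mono fact_mono)
  qed
  also have "\<dots> \<le> real (n choose 2) * ?w"
    using w card_ordered_pairs[of n] card_Diff1_le[of ?I "(1, n)"] by (simp add: mult_right_mono)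
  finally have rest: "\<bar>sum ?f (?I - {(1, n)})\<bar> \<le> real (n choose 2) * ?w" .
  have C: "2 * real (n choose 2) = real n * (real n - 1)"
  proof -
    have "even (n * (n - 1))" by auto
    then have "2 * (n choose 2) = n * (n - 1)" by (simp add: choose_two)
    then have "2 * real (n choose 2) = real (n * (n - 1))"
      by (metis of_nat_mult of_nat_numeral)
    then show ?thesis using \<open>n \<ge> 2\<close> by (simp add: of_nat_diff)
  qed
  \<comment> \<open>The left side is \<open>(n ^ 3 - n) / 2\<close>. So after
    \<open>n choose 2\<close> units of \<open>?w\<close> are given up to the other pairs, at least
    \<open>n * (n choose 2)\<close> of the \<open>n ^ 3\<close> units remain.\<close>
  have "real (n choose 2) * (real n + 1) \<le> real n ^ 3"
  proof -
    have "2 * (real (n choose 2) * (real n + 1)) = real n ^ 3 - real n"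
      using arg_cong[OF C, of "\<lambda>x. x * (real n + 1)"]
      by (simp add: algebra_simps power3_eq_cube)
    moreover have "real n ^ 3 \<ge> 0" by simp
    ultimately show ?thesis by linarith
  qed
  then have "real (n choose 2) * real n \<le> real n ^ 3 - real (n choose 2)"
    by (simp add: algebra_simps)
  also have "\<dots> \<le> (real n ^ 3 - real (n choose 2)) * ?w"
  proof -
    have "0 \<le> real n ^ 3 - real (n choose 2)"
      using calculation by (smt (verit) mult_nonneg_nonneg of_nat_0_le_iff)
    with w show ?thesis by (simp add: mult_le_cancel_left1)
  qed
  also have "\<dots> = \<bar>?f (1, n)\<bar> - real (n choose 2) * ?w"
    using top by (simp add: algebra_simps)
  also have "\<dots> \<le> \<bar>?f (1, n)\<bar> - \<bar>sum ?f (?I - {(1, n)})\<bar>"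
    using rest by simp
  also have "\<dots> \<le> \<bar>?f (1, n) + sum ?f (?I - {(1, n)})\<bar>"
    by linarith
  also have "?f (1, n) + sum ?f (?I - {(1, n)}) = sum ?f ?I"
    by (rule sum.remove[OF fin mem, symmetric])
  finally show ?thesis .
qed

section \<open>Divergence\<close>

text \<open>A limit \<open>Z\<close> is real-valued, so the event that
  \<open>\<bar>Z\<bar> + 1\<close> reaches \<open>n\<close> has vanishing probability. Off this
  event and a null set, \<open>Y n\<close> lies more than 1 away from \<open>Z\<close>.\<close>

lemma (in prob_space) not_converges_in_probability_of_AE_ge:
  assumes Y: "\<And>n. Y n \<in> borel_measurable M" and Z: "Z \<in> borel_measurable M"
    and ge: "\<And>n. n \<ge> 2 \<Longrightarrow> AE \<omega> in M. \<bar>Y n \<omega>\<bar> \<ge> real n"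
  shows "\<not> converges_in_probability M Y Z"
proof
  note [measurable] = Y Z
  assume "converges_in_probability M Y Z"
  then have lim: "(\<lambda>n. prob {\<omega> \<in> space M. \<bar>Y n \<omega> - Z \<omega>\<bar> > 1}) \<longlonglongrightarrow> 0"
    unfolding converges_in_probability_def by simp
  let ?T = "\<lambda>n. {\<omega> \<in> space M. real n \<le> \<bar>Z \<omega>\<bar> + 1}"
  \<comment> \<open>Continuity from above along decreasing events; their intersection is empty by
    the Archimedean property.\<close>
  have "(\<lambda>n. prob (?T n)) \<longlonglongrightarrow> prob (\<Inter>n. ?T n)"
    by (rule finite_Lim_measure_decseq) (auto simp: decseq_def)
  also have "(\<Inter>n. ?T n) = {}"
  proof safe
    fix \<omega> assume *: "\<omega> \<in> (\<Inter>n. ?T n)"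
    obtain n where "real n > \<bar>Z \<omega>\<bar> + 1"
      using reals_Archimedean2 by blast
    moreover from * have "real n \<le> \<bar>Z \<omega>\<bar> + 1" by blast
    ultimately show "\<omega> \<in> {}" by simp
  qed
  finally have T: "(\<lambda>n. prob (?T n)) \<longlonglongrightarrow> 0"
    by simp
  \<comment> \<open>If \<open>\<bar>Y n - Z\<bar> \<le> 1\<close> and
    \<open>\<bar>Y n\<bar> \<ge> n\<close>, then \<open>\<bar>Z\<bar> + 1 \<ge> n\<close>; so the
    two events cover almost all of the space.\<close>
  have le: "1 \<le> prob {\<omega> \<in> space M. \<bar>Y n \<omega> - Z \<omega>\<bar> > 1} + prob (?T n)" if "n \<ge> 2" for n
  proof -
    have "AE \<omega> in M. \<omega> \<in> {\<omega> \<in> space M. \<bar>Y n \<omega> - Z \<omega>\<bar> > 1} \<union> ?T n"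
      using ge[OF that] AE_space by eventually_elim auto
    then have "prob ({\<omega> \<in> space M. \<bar>Y n \<omega> - Z \<omega>\<bar> > 1} \<union> ?T n) = 1"
      by (subst prob_eq_1) auto
    then show ?thesis
      using measure_Un_le[of "{\<omega> \<in> space M. \<bar>Y n \<omega> - Z \<omega>\<bar> > 1}" M "?T n"] by simp
  qed
  have "(1::real) \<le> 0 + 0"
    by (rule LIMSEQ_le_const[OF tendsto_add[OF lim T]]) (use le in blast)
  then show False by simp
qed

theorem proposition4p2:
  shows "\<exists>(M :: (nat \<Rightarrow> real) measure) (X :: nat \<Rightarrow> (nat \<Rightarrow> real) \<Rightarrow> real) (h :: real \<Rightarrow> real \<Rightarrow> real).
    prob_space M \<and>
    (\<forall>i\<ge>1. X i \<in> borel_measurable M) \<and>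
    strictly_stationary M X \<and>
    ergodic_process M X \<and>
    (\<lambda>(x, y). h x y) \<in> borel_measurable (borel \<Otimes>\<^sub>M borel) \<and>
    (\<forall>x y. h x y = h y x) \<and>
    (\<forall>i j. 1 \<le> i \<and> i < j \<longrightarrow> integrable M (\<lambda>\<omega>. h (X i \<omega>) (X j \<omega>))) \<and>
    \<not> (\<exists>Z \<in> borel_measurable M.
        converges_in_probability M
          (\<lambda>n \<omega>. inverse (real (n choose 2)) *
             (\<Sum>(i, j)\<in>{(i, j). 1 \<le> i \<and> i < j \<and> j \<le> n}.
                h (X i \<omega>) (X j \<omega>) - (\<integral>\<omega>'. h (X i \<omega>') (X j \<omega>') \<partial>M)))
          Z)"
proof -
  let ?Y = "\<lambda>n \<omega>. inverse (real (n choose 2)) *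
      (\<Sum>(i, j)\<in>{(i, j). 1 \<le> i \<and> i < j \<and> j \<le> n}.
        lag_kernel (code_process i \<omega>) (code_process j \<omega>) -
        (\<integral>\<omega>'. lag_kernel (code_process i \<omega>') (code_process j \<omega>') \<partial>fair_space))"
  have code [measurable]: "sign_code \<in> borel_measurable fair_space"
    by (rule measurable_sign_code) simp
  have meas: "?Y n \<in> borel_measurable fair_space" for n
    by (intro borel_measurable_times borel_measurable_const borel_measurable_sum)
       (auto intro!: borel_measurable_diff borel_measurable_integrable integrable_lag_kernel)
  \<comment> \<open>The centering terms vanish, and dividing the lower bound for the sign sum by
    \<open>n choose 2\<close> leaves \<open>n\<close>. At \<open>n = 1\<close> the average is 0
    because \<open>inverse 0 = 0\<close>, so the bound starts at 2.\<close>
  have ge: "AE \<omega> in fair_space. \<bar>?Y n \<omega>\<bar> \<ge> real n" if "n \<ge> 2" for n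
    using AE_lag_kernel
  proof eventually_elim
    case (elim \<omega>)
    let ?S = "\<Sum>(i, j)\<in>{(i, j). 1 \<le> i \<and> i < j \<and> j \<le> n}.
        sign_bit (\<omega> i) * sign_bit (\<omega> j) * lag_weight (j - i)"
    have eq: "?Y n \<omega> = inverse (real (n choose 2)) * ?S"
      by (rule arg_cong[where f = "(*) _"], rule sum.cong) (use elim in \<open>auto simp: expectation_lag_kernel\<close>)
    have "real (n choose 2) > 0"
      using that by (simp add: zero_less_binomial)
    moreover have "real (n choose 2) * real n \<le> \<bar>?S\<bar>"
      by (rule weighted_sign_sum_ge[OF that]) simp
    ultimately show ?case
      unfolding eq by (simp add: abs_mult field_simps)
  qed
  have "\<not> (\<exists>Z \<in> borel_measurable fair_space. converges_in_probability fair_space ?Y Z)"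
    using fair.P.not_converges_in_probability_of_AE_ge[OF meas _ ge] by blast
  moreover have "\<forall>i\<ge>1. code_process i \<in> borel_measurable fair_space"
    by measurable
  ultimately show ?thesis
    using fair.P.prob_space_axioms measurable_lag_kernel lag_kernel_commute integrable_lag_kernel
      strictly_stationary_shift_process[OF prob_space_fair_law code]
      ergodic_shift_process[OF prob_space_fair_law code]
    by (intro exI[of _ fair_space] exI[of _ code_process] exI[of _ lag_kernel]) blast
qed

end
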